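(* For any $P,Q\in\mathcal P(X)$, $Q\succeq_{\Phi;k,K;m,M}P$ if and only if $$-k\int_\Theta\Gamma_{P,Q}\,dm+(1-k)\,\mathrm{CVaR}_C^{\overline R}(-\Gamma_{P,Q})\le0.$$
   Context: Let $X$ be a Polish space with Borel $\sigma$-algebra $\mathscr X$ and $(\Theta,\mathscr A)$ a measurable space; $\mathcal P(X)$, $\mathcal P(\Theta)$ are the sets of probability measures. Let $\varphi:X\times\Theta\to\mathbb R$ be $\mathscr X\otimes\mathscr A$-measurable and bounded; write $\varphi_\theta(x):=\varphi(x,\theta)$, $\Phi=(\varphi_\theta)_{\theta\in\Theta}$, and $\Gamma_{P,Q}(\theta):=\mathbb E_Q[\varphi_\theta]-\mathbb E_P[\varphi_\theta]$. Let $m,M\in\mathcal P(\Theta)$ and $0\le k<1\le K<\infty$ with $k\,m(B)\le K\,M(B)$ for all $B\in\mathscr A$. For finite measures, $\mu\le\nu$ means $\mu(B)\le\nu(B)$ for all measurable $B$. Put $\mathcal P_{k,K;m,M}:=\{\Pi\in\mathcal P(\Theta):km\le\Pi\le KM\}$ and $$\mathcal U_{\Phi;k,K;m,M}:=\Big\{u(x)=a+\tau\int_\Theta\varphi_\theta(x)\,\Pi(d\theta):a\in\mathbb R,\ \tau\ge0,\ \Pi\in\mathcal P_{k,K;m,M}\Big\}.$$ Reference-weighted stochastic dominance (RWSD): $Q\succeq_{\Phi;k,K;m,M}P$ means $\mathbb E_Q[u]\ge\mathbb E_P[u]$ for every $u\in\mathcal U_{\Phi;k,K;m,M}$. Set $\overline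 R:=\dfrac{KM-km}{K-k}$ (a probability measure) and $C:=\dfrac{K-k}{1-k}\ge1$. For a probability measure $\rho$ on $\Theta$, bounded measurable $L:\Theta\to\mathbb R$ and $C\ge1$, $$\mathrm{CVaR}_C^\rho(L):=\inf_{\eta\in\mathbb R}\Big\{\eta+C\int_\Theta(L-\eta)_+\,d\rho\Big\},\qquad t_+:=\max\{t,0\}.$$ *)

theory Defs
  imports "HOL-Probability.Probability"
begin

text \<open>
  The measurable space of parameters is a measure \<open>A\<close> of which only \<open>space A\<close> and \<open>sets A\<close> are
  used. The set of probability measures on it is \<open>space (prob_algebra A)\<close>.
\<close>

definition Gamma_diff :: "('x \<times> 't \<Rightarrow> real) \<Rightarrow> 'x measure \<Rightarrow> 'x measure \<Rightarrow> 't \<Rightarrow> real" where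
  "Gamma_diff \<phi> P Q \<theta> = (\<integral>x. \<phi> (x, \<theta>) \<partial>Q) - (\<integral>x. \<phi> (x, \<theta>) \<partial>P)"

definition ref_weights ::
    "'t measure \<Rightarrow> real \<Rightarrow> real \<Rightarrow> 't measure \<Rightarrow> 't measure \<Rightarrow> 't measure set" where
  "ref_weights A k K m M = {\<pi> \<in> space (prob_algebra A).
     (\<forall>B\<in>sets A. k * measure m B \<le> measure \<pi> B) \<and>
     (\<forall>B\<in>sets A. measure \<pi> B \<le> K * measure M B)}"

definition ref_utilities ::
    "'t measure \<Rightarrow> ('x \<times> 't \<Rightarrow> real) \<Rightarrow> real \<Rightarrow> real \<Rightarrow> 't measure \<Rightarrow> 't measure \<Rightarrow> ('x \<Rightarrow> real) set" where
  "ref_utilities A \<phi> k K m M =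
     {\<lambda>x. a + \<tau> * (\<integral>\<theta>. \<phi> (x, \<theta>) \<partial>\<pi>) | a \<tau> \<pi>. 0 \<le> \<tau> \<and> \<pi> \<in> ref_weights A k K m M}"

definition rwsd ::
    "'t measure \<Rightarrow> ('x \<times> 't \<Rightarrow> real) \<Rightarrow> real \<Rightarrow> real \<Rightarrow> 't measure \<Rightarrow> 't measure
      \<Rightarrow> 'x measure \<Rightarrow> 'x measure \<Rightarrow> bool" where
  "rwsd A \<phi> k K m M Q P \<longleftrightarrow>
     (\<forall>u\<in>ref_utilities A \<phi> k K m M. (\<integral>x. u x \<partial>Q) \<ge> (\<integral>x. u x \<partial>P))"

definition Rbar :: "real \<Rightarrow> real \<Rightarrow> 't measure \<Rightarrow> 't measure \<Rightarrow> 't measure" where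
  "Rbar k K m M = scale_measure (ennreal (1 / (K - k)))
     (diff_measure (scale_measure (ennreal K) M) (scale_measure (ennreal k) m))"

text \<open>
  For \<open>C \<ge> 1\<close>, a probability measure \<open>\<rho>\<close> and bounded measurable \<open>L\<close> the infimum is over a set
  bounded below by the \<open>\<rho>\<close>-mean of \<open>L\<close>, so the conditionally complete \<open>Inf\<close> is the true infimum.
\<close>
definition CVaR :: "real \<Rightarrow> 't measure \<Rightarrow> ('t \<Rightarrow> real) \<Rightarrow> real" where
  "CVaR C \<rho> L = (INF \<eta>. \<eta> + C * (\<integral>\<theta>. max (L \<theta> - \<eta>) 0 \<partial>\<rho>))"

lemma
  assumes "m \<in> space (prob_algebra A)" "M \<in> space (prob_algebra A)"
    and "0 \<le> k" "k < 1" "1 \<le> K"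
    and le: "\<And>B. B \<in> sets A \<Longrightarrow> k * measure m B \<le> K * measure M B"
  shows measure_Rbar:
      "\<And>B. B \<in> sets A \<Longrightarrow> measure (Rbar k K m M) B = (K * measure M B - k * measure m B) / (K - k)"
    and Rbar_in_prob_algebra: "Rbar k K m M \<in> space (prob_algebra A)"
proof -
  have s: "sets m = sets A" "sets M = sets A" and pr: "prob_space m" "prob_space M"
    using assms(1,2) by (auto simp: space_prob_algebra)
  interpret m: prob_space m by fact
  interpret M: prob_space M by fact
  have fin: "finite_measure (scale_measure (ennreal K) M)" "finite_measure (scale_measure (ennreal k) m)"
    by (auto intro!: finite_measureI simp: space_scale_measure M.emeasure_space_1 m.emeasure_space_1)
  have em: "emeasure (Rbar k K m M) B = ennreal ((K * measure M B - k * measure m B) / (K - k))"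
    if B: "B \<in> sets A" for B
  proof -
    have "emeasure (diff_measure (scale_measure (ennreal K) M) (scale_measure (ennreal k) m)) B
        = emeasure (scale_measure (ennreal K) M) B - emeasure (scale_measure (ennreal k) m) B"
      by (rule emeasure_diff_measure[OF fin])
        (use assms(3-5) s B le in \<open>auto simp: M.emeasure_eq_measure m.emeasure_eq_measure
          ennreal_mult'[symmetric]\<close>)
    also have "\<dots> = ennreal (K * measure M B - k * measure m B)"
      using assms(3-5) by (simp add: M.emeasure_eq_measure m.emeasure_eq_measure
          ennreal_mult'[symmetric] ennreal_minus)
    finally show ?thesis
      using assms(3-5) le[OF B] by (simp add: Rbar_def ennreal_mult'[symmetric])
  qed
  show "measure (Rbar k K m M) B = (K * measure M B - k * measure m B) / (K - k)"
    if "B \<in> sets A" for B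
    using em[OF that] le[OF that] assms(3-5) by (simp add: measure_def)
  have sR: "sets (Rbar k K m M) = sets A" by (simp add: Rbar_def s)
  have sp: "space (Rbar k K m M) = space A" by (rule sets_eq_imp_space_eq[OF sR])
  have spm: "space m = space A" "space M = space A" using s by (auto dest: sets_eq_imp_space_eq)
  have "emeasure (Rbar k K m M) (space (Rbar k K m M)) = 1"
    using em[of "space A"] m.prob_space M.prob_space assms(3-5) by (simp add: sp spm)
  then show "Rbar k K m M \<in> space (prob_algebra A)"
    by (auto simp: space_prob_algebra sR intro!: prob_spaceI)
qed

end

theory Submission
  imports Defs
begin

text \<open>
  By Fubini, dominance says that \<open>L = -\<Gamma>\<close> has a nonpositive integral against every admissible \<open>\<Pi>\<close>.
  Splitting \<open>L - \<eta>\<close> into positive and negative parts and using \<open>\<Pi> \<le> K M\<close> on the first and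
  \<open>k m \<le> \<Pi>\<close> on the second bounds each such integral by
  \<open>k \<integral>L dm + (1 - k) (\<eta> + C \<integral>(L - \<eta>)\<^sub>+ dR)\<close> for every \<open>\<eta>\<close>. The bound is attained: if \<open>\<eta>\<close> is a
  \<open>(1 - 1/C)\<close>-quantile of \<open>L\<close> under \<open>R\<close>, put \<open>\<Pi> = k m + (1 - k) g R\<close>, where the density \<open>g\<close> is
  \<open>C\<close> above the level \<open>\<eta>\<close>, \<open>0\<close> below it, and constant on the level set so that \<open>\<integral>g dR = 1\<close>.
\<close>

section \<open>Integrals under linear combinations and inequalities of measures\<close>

text \<open>Induction on measurable functions: the hypothesis is the case of indicators, and both
  sides respect sums, multiples and increasing limits. Only values on sets are compared, so the
  lemma fits any \<open>\<rho>\<close>, however it was constructed.\<close>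

lemma nn_integral_linear_combination:
  assumes sets: "sets \<mu> = sets \<rho>" "sets \<nu> = sets \<rho>"
    and em: "\<And>B. B \<in> sets \<rho> \<Longrightarrow> emeasure \<rho> B = a * emeasure \<mu> B + b * emeasure \<nu> B"
    and f: "f \<in> borel_measurable \<rho>"
  shows "(\<integral>\<^sup>+x. f x \<partial>\<rho>) = a * (\<integral>\<^sup>+x. f x \<partial>\<mu>) + b * (\<integral>\<^sup>+x. f x \<partial>\<nu>)"
proof -
  note sets[measurable_cong]
  have sp: "space \<mu> = space \<rho>" "space \<nu> = space \<rho>"
    using sets by (auto dest: sets_eq_imp_space_eq)
  show ?thesis
    using f
  proof (induction rule: borel_measurable_induct)
    case (cong f g)
    have "(\<integral>\<^sup>+x. f x \<partial>N) = (\<integral>\<^sup>+x. g x \<partial>N)" if "space N = space \<rho>" for N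
      using cong(3) that by (intro nn_integral_cong) auto
    with cong(4) sp show ?case by simp
  next
    case (set B)
    then show ?case by (simp add: em sets)
  next
    case (mult u c)
    then show ?case by (simp add: nn_integral_cmult distrib_left mult.left_commute)
  next
    case (add u v)
    then show ?case by (simp add: nn_integral_add distrib_left add_ac)
  next
    case (seq U)
    then have IH: "integral\<^sup>N \<rho> (U i) = a * integral\<^sup>N \<mu> (U i) + b * integral\<^sup>N \<nu> (U i)" for i
      by simp
    \<comment> \<open>Suprema may be added termwise only along increasing sequences, hence
      monotonicity for each of the two scaled integrals.\<close>
    have mono: "incseq (\<lambda>i. c * integral\<^sup>N N (U i))" for N and c :: ennreal
      using seq(3) by (auto simp: incseq_def le_fun_def intro!: mult_left_mono nn_integral_mono)
    have SUP: "(\<integral>\<^sup>+x. (SUP i. U i) x \<partial>N) = (SUP i. integral\<^sup>N N (U i))" if "sets N = sets \<rho>" for N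
      using seq that by (simp add: image_image nn_integral_monotone_convergence_SUP
          cong: measurable_cong_sets)
    show ?case
      by (simp only: SUP sets IH SUP_mult_left_ennreal ennreal_SUP_add[OF mono mono])
  qed
qed

text \<open>Adding the bound \<open>b\<close> makes \<open>f\<close> nonnegative, which carries
  statements on nonnegative integrals over to bounded signed functions. Nonnegativity of the shifted
  integral allows \<open>ennreal\<close> to be cancelled afterwards.\<close>

lemma (in finite_measure) ennreal_integral_shift:
  fixes f :: "'a \<Rightarrow> real"
  assumes [measurable]: "f \<in> borel_measurable M"
    and b: "\<And>x. x \<in> space M \<Longrightarrow> \<bar>f x\<bar> \<le> b"
  shows "ennreal (integral\<^sup>L M f + b * measure M (space M)) = (\<integral>\<^sup>+x. ennreal (f x + b) \<partial>M)"
    and "0 \<le> integral\<^sup>L M f + b * measure M (space M)"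
proof -
  have i: "integrable M f" using b by (intro integrable_const_bound[where B=b]) auto
  have nn: "0 \<le> f x + b" if "x \<in> space M" for x using b[OF that] by linarith
  have eq: "integral\<^sup>L M f + b * measure M (space M) = (\<integral>x. f x + b \<partial>M)"
    using i by (simp add: mult.commute)
  show "ennreal (integral\<^sup>L M f + b * measure M (space M)) = (\<integral>\<^sup>+x. ennreal (f x + b) \<partial>M)"
    unfolding eq using i nn by (subst nn_integral_eq_integral) auto
  show "0 \<le> integral\<^sup>L M f + b * measure M (space M)"
    unfolding eq using nn by (intro integral_nonneg_AE) auto
qed

lemma integral_linear_combination:
  fixes f :: "'a \<Rightarrow> real"
  assumes fin: "finite_measure \<mu>" "finite_measure \<nu>" "finite_measure \<rho>"
    and sets: "sets \<mu> = sets \<rho>" "sets \<nu> = sets \<rho>"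
    and "0 \<le> a" "0 \<le> b"
    and me: "\<And>B. B \<in> sets \<rho> \<Longrightarrow> measure \<rho> B = a * measure \<mu> B + b * measure \<nu> B"
    and [measurable]: "f \<in> borel_measurable \<rho>"
    and c: "\<And>x. x \<in> space \<rho> \<Longrightarrow> \<bar>f x\<bar> \<le> c"
  shows "integral\<^sup>L \<rho> f = a * integral\<^sup>L \<mu> f + b * integral\<^sup>L \<nu> f"
proof -
  note sets[measurable_cong]
  interpret \<mu>: finite_measure \<mu> by fact
  interpret \<nu>: finite_measure \<nu> by fact
  interpret \<rho>: finite_measure \<rho> by fact
  have sp: "space \<mu> = space \<rho>" "space \<nu> = space \<rho>"
    using sets by (auto dest: sets_eq_imp_space_eq)
  have "(\<integral>\<^sup>+x. ennreal (f x + c) \<partial>\<rho>)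
      = ennreal a * (\<integral>\<^sup>+x. ennreal (f x + c) \<partial>\<mu>) + ennreal b * (\<integral>\<^sup>+x. ennreal (f x + c) \<partial>\<nu>)"
    using \<open>0 \<le> a\<close> \<open>0 \<le> b\<close> by (intro nn_integral_linear_combination)
      (auto simp: sets me \<mu>.emeasure_eq_measure \<nu>.emeasure_eq_measure \<rho>.emeasure_eq_measure
        ennreal_mult' ennreal_plus[symmetric] simp del: ennreal_plus simp flip: ennreal_mult')
  moreover note \<rho>.ennreal_integral_shift[of f c] \<mu>.ennreal_integral_shift[of f c]
    \<nu>.ennreal_integral_shift[of f c]
  ultimately have "ennreal (integral\<^sup>L \<rho> f + c * measure \<rho> (space \<rho>))
      = ennreal (a * (integral\<^sup>L \<mu> f + c * measure \<mu> (space \<rho>))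
        + b * (integral\<^sup>L \<nu> f + c * measure \<nu> (space \<rho>)))"
    and "0 \<le> integral\<^sup>L \<rho> f + c * measure \<rho> (space \<rho>)"
    and "0 \<le> a * (integral\<^sup>L \<mu> f + c * measure \<mu> (space \<rho>))
        + b * (integral\<^sup>L \<nu> f + c * measure \<nu> (space \<rho>))"
    using c \<open>0 \<le> a\<close> \<open>0 \<le> b\<close> by (simp_all add: sp ennreal_plus ennreal_mult')
  then have "integral\<^sup>L \<rho> f + c * measure \<rho> (space \<rho>)
      = a * (integral\<^sup>L \<mu> f + c * measure \<mu> (space \<rho>)) + b * (integral\<^sup>L \<nu> f + c * measure \<nu> (space \<rho>))"
    by (simp add: ennreal_inj)
  \<comment> \<open>The relation \<open>me\<close> on the whole space balances the total masses, so
    the shifts by \<open>c\<close> cancel.\<close>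
  with me[OF sets.top] show ?thesis by (simp add: algebra_simps)
qed

text \<open>Nonnegative integrals are monotone in the measure. A coefficient on each side lets the
  same lemma serve both constraints, \<open>\<pi> \<le> K M\<close> and
  \<open>k m \<le> \<pi>\<close>.\<close>

lemma integral_mono_measure_le:
  fixes f :: "'a \<Rightarrow> real"
  assumes fin: "finite_measure \<mu>" "finite_measure \<nu>"
    and sets: "sets \<mu> = sets \<nu>"
    and "0 \<le> a" "0 \<le> b"
    and me: "\<And>B. B \<in> sets \<nu> \<Longrightarrow> a * measure \<mu> B \<le> b * measure \<nu> B"
    and [measurable]: "f \<in> borel_measurable \<nu>"
    and c: "\<And>x. x \<in> space \<nu> \<Longrightarrow> 0 \<le> f x \<and> f x \<le> c"
  shows "a * integral\<^sup>L \<mu> f \<le> b * integral\<^sup>L \<nu> f"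
proof -
  note sets[measurable_cong]
  interpret \<mu>: finite_measure \<mu> by fact
  interpret \<nu>: finite_measure \<nu> by fact
  have sp: "space \<mu> = space \<nu>" using sets by (auto dest: sets_eq_imp_space_eq)
  have i: "integrable \<mu> f" "integrable \<nu> f"
    using c sp by (auto intro!: \<mu>.integrable_const_bound[where B=c] \<nu>.integrable_const_bound[where B=c])
  have nn: "0 \<le> integral\<^sup>L \<mu> f" "0 \<le> integral\<^sup>L \<nu> f"
    using c sp by (auto intro!: integral_nonneg_AE)
  have "scale_measure a \<mu> \<le> scale_measure b \<nu>"
    using \<open>0 \<le> a\<close> \<open>0 \<le> b\<close> me
    by (subst le_measure) (auto simp: sets \<mu>.emeasure_eq_measure \<nu>.emeasure_eq_measure
        simp flip: ennreal_mult')
  then have "(\<integral>\<^sup>+x. f x \<partial>scale_measure a \<mu>) \<le> (\<integral>\<^sup>+x. f x \<partial>scale_measure b \<nu>)"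
    by (intro nn_integral_mono_measure) (auto simp: sets)
  then have "ennreal a * (\<integral>\<^sup>+x. f x \<partial>\<mu>) \<le> ennreal b * (\<integral>\<^sup>+x. f x \<partial>\<nu>)"
    by (simp add: nn_integral_scale_measure)
  moreover have "(\<integral>\<^sup>+x. f x \<partial>\<mu>) = integral\<^sup>L \<mu> f" "(\<integral>\<^sup>+x. f x \<partial>\<nu>) = integral\<^sup>L \<nu> f"
    using i c sp by (auto intro!: nn_integral_eq_integral)
  ultimately show ?thesis
    using nn \<open>0 \<le> a\<close> \<open>0 \<le> b\<close> by (simp flip: ennreal_mult')
qed

text \<open>Provides the extremal weight, a mixture of the floor measure \<open>m\<close> with a
  measure concentrated on large losses.\<close>

lemma ex_mixture_prob_algebra:
  assumes \<mu>: "\<mu> \<in> space (prob_algebra A)" and \<nu>: "\<nu> \<in> space (prob_algebra A)"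
    and "0 \<le> k" "k \<le> 1"
  obtains \<pi> where "\<pi> \<in> space (prob_algebra A)"
    "\<And>B. B \<in> sets A \<Longrightarrow> measure \<pi> B = k * measure \<mu> B + (1 - k) * measure \<nu> B"
proof -
  have s: "sets \<mu> = sets A" "sets \<nu> = sets A" and pr: "prob_space \<mu>" "prob_space \<nu>"
    using \<mu> \<nu> by (auto simp: space_prob_algebra)
  interpret \<mu>: prob_space \<mu> by fact
  interpret \<nu>: prob_space \<nu> by fact
  have sp: "space \<mu> = space A" "space \<nu> = space A"
    using s by (auto dest: sets_eq_imp_space_eq)
  let ?e = "\<lambda>B. ennreal k * emeasure \<mu> B + ennreal (1 - k) * emeasure \<nu> B"
  define \<pi> where "\<pi> = measure_of (space A) (sets A) ?e"
  have sets_\<pi>: "sets \<pi> = sets A" by (simp add: \<pi>_def)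
  have em: "emeasure \<pi> B = ?e B" if "B \<in> sets A" for B
    unfolding \<pi>_def
  proof (rule emeasure_measure_of_sigma)
    show "sigma_algebra (space A) (sets A)" ..
    show "positive (sets A) ?e" by (simp add: positive_def)
    show "countably_additive (sets A) ?e"
    proof (rule countably_additiveI)
      fix F :: "nat \<Rightarrow> 'a set"
      assume F: "range F \<subseteq> sets A" "disjoint_family F" "(\<Union>i. F i) \<in> sets A"
      then have "(\<Sum>i. emeasure \<mu> (F i)) = emeasure \<mu> (\<Union>i. F i)"
        "(\<Sum>i. emeasure \<nu> (F i)) = emeasure \<nu> (\<Union>i. F i)"
        by (auto intro!: suminf_emeasure simp: s)
      then show "(\<Sum>i. ?e (F i)) = ?e (\<Union>i. F i)"
        by (simp add: suminf_add[symmetric])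
    qed
  qed fact
  have me: "emeasure \<pi> B = ennreal (k * measure \<mu> B + (1 - k) * measure \<nu> B)" if "B \<in> sets A" for B
    using em[OF that] assms by (simp add: \<mu>.emeasure_eq_measure \<nu>.emeasure_eq_measure
        ennreal_mult' ennreal_plus)
  show thesis
  proof
    have "emeasure \<pi> (space \<pi>) = 1"
      using me[of "space A"] \<mu>.prob_space \<nu>.prob_space sp sets_eq_imp_space_eq[OF sets_\<pi>] by simp
    then show "\<pi> \<in> space (prob_algebra A)"
      by (auto simp: space_prob_algebra sets_\<pi> intro!: prob_spaceI)
    show "measure \<pi> B = k * measure \<mu> B + (1 - k) * measure \<nu> B" if "B \<in> sets A" for B
      unfolding measure_def[of \<pi>] me[OF that] using assms by (simp del: ennreal_plus)
  qed
qed

section \<open>Quantiles and the extremal density for CVaR\<close>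

text \<open>The levels \<open>t\<close> with \<open>C * prob {L > t} \<le> 1\<close> form an upward
  closed set; its infimum satisfies both inequalities by continuity of the measure along levels
  approaching it from above and from below.\<close>

lemma (in prob_space) ex_upper_quantile:
  fixes L :: "'a \<Rightarrow> real"
  assumes [measurable]: "L \<in> borel_measurable M"
    and b: "\<And>x. x \<in> space M \<Longrightarrow> \<bar>L x\<bar> \<le> b"
    and "1 \<le> C"
  obtains \<eta> where "C * prob {x \<in> space M. \<eta> < L x} \<le> 1" "1 \<le> C * prob {x \<in> space M. \<eta> \<le> L x}"
proof (cases "C = 1")
  \<comment> \<open>For \<open>C = 1\<close> every real level meets the first inequality, so there
    is no finite infimum; the lower bound \<open>-b\<close> of \<open>L\<close> works
    directly.\<close>
  case True
  have "-b \<le> L x" if "x \<in> space M" for x using b[OF that] by linarith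
  then have "{x \<in> space M. -b \<le> L x} = space M" by auto
  then show thesis using True prob_space by (intro that[of "-b"]) auto
next
  case False
  with \<open>1 \<le> C\<close> have "1 < C" by simp
  define S where "S = {t. C * prob {x \<in> space M. t < L x} \<le> 1}"
  have "{x \<in> space M. b < L x} = {}" by (auto dest!: b)
  then have "b \<in> S" by (simp add: S_def del: Collect_empty_eq)
  \<comment> \<open>Below \<open>-b\<close> the event is the whole space, and
    \<open>C * 1 \<le> 1\<close> contradicts \<open>1 < C\<close>.\<close>
  have lower: "-b \<le> t" if "t \<in> S" for t
  proof (rule ccontr)
    assume "\<not> -b \<le> t"
    then have "t < L x" if "x \<in> space M" for x using b[OF that] by linarith
    then have "{x \<in> space M. t < L x} = space M" by auto
    with that \<open>1 < C\<close> prob_space show False by (simp add: S_def)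
  qed
  then have bdd: "bdd_below S" by (auto simp: bdd_below_def)
  define \<eta> where "\<eta> = Inf S"
  have up: "t \<in> S" if "s \<in> S" "s \<le> t" for s t
  proof -
    have "prob {x \<in> space M. t < L x} \<le> prob {x \<in> space M. s < L x}"
      using that by (intro finite_measure_mono) auto
    then have "C * prob {x \<in> space M. t < L x} \<le> C * prob {x \<in> space M. s < L x}"
      using \<open>1 < C\<close> by simp
    with that show ?thesis by (simp add: S_def)
  qed
  have above: "t \<in> S" if "\<eta> < t" for t
  proof -
    obtain s where "s \<in> S" "s < t"
      using cInf_lessD[of S t] \<open>b \<in> S\<close> \<open>\<eta> < t\<close> unfolding \<eta>_def by blast
    then show ?thesis using up[of s t] by simp
  qed
  have below: "t \<notin> S" if "t < \<eta>" for t
    using cInf_lower[OF _ bdd, of t] that by (auto simp: \<eta>_def)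
  show thesis
  proof
    \<comment> \<open>Levels strictly above \<open>\<eta>\<close> lie in \<open>S\<close>, and their
      events increase to the strict one \<open>{L > \<eta>}\<close>.\<close>
    let ?F = "\<lambda>n. {x \<in> space M. \<eta> + 1 / real (Suc n) < L x}"
    have "(\<lambda>n. prob (?F n)) \<longlonglongrightarrow> prob (\<Union>n. ?F n)"
    proof (rule finite_Lim_measure_incseq)
      show "incseq ?F"
        by (auto simp: incseq_def intro: le_less_trans[rotated] intro!: divide_left_mono add_left_mono)
    qed auto
    moreover have "(\<Union>n. ?F n) = {x \<in> space M. \<eta> < L x}"
    proof (intro set_eqI iffI)
      fix x assume "x \<in> (\<Union>n. ?F n)"
      then obtain n where x: "x \<in> space M" "\<eta> + 1 / real (Suc n) < L x" by auto
      moreover have "0 < 1 / real (Suc n)" by simp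
      ultimately have "\<eta> < L x" by linarith
      with x show "x \<in> {x \<in> space M. \<eta> < L x}" by simp
    next
      fix x assume "x \<in> {x \<in> space M. \<eta> < L x}"
      with reals_Archimedean[of "L x - \<eta>"] show "x \<in> (\<Union>n. ?F n)"
        by (auto simp: field_simps)
    qed
    ultimately have "(\<lambda>n. C * prob (?F n)) \<longlonglongrightarrow> C * prob {x \<in> space M. \<eta> < L x}"
      by (intro tendsto_mult) auto
    moreover have "C * prob (?F n) \<le> 1" for n
      using above[of "\<eta> + 1 / real (Suc n)"] by (simp add: S_def)
    ultimately show "C * prob {x \<in> space M. \<eta> < L x} \<le> 1"
      by (intro LIMSEQ_le_const2) auto
  next
    \<comment> \<open>Levels strictly below \<open>\<eta>\<close> lie outside \<open>S\<close>, and
      their events decrease to \<open>{L \<ge> \<eta>}\<close>, which includes the level set; the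
      strict bound \<open>> 1\<close> becomes \<open>\<ge> 1\<close> in the limit.\<close>
    let ?F = "\<lambda>n. {x \<in> space M. \<eta> - 1 / real (Suc n) < L x}"
    have "(\<lambda>n. prob (?F n)) \<longlonglongrightarrow> prob (\<Inter>n. ?F n)"
    proof (rule finite_Lim_measure_decseq)
      show "decseq ?F"
        by (auto simp: decseq_def intro: le_less_trans[rotated] intro!: divide_left_mono diff_left_mono)
    qed auto
    moreover have "(\<Inter>n. ?F n) = {x \<in> space M. \<eta> \<le> L x}"
    proof (intro set_eqI iffI)
      fix x assume x: "x \<in> (\<Inter>n. ?F n)"
      have "\<eta> \<le> L x"
      proof (rule ccontr)
        assume "\<not> \<eta> \<le> L x"
        then obtain n where "inverse (real (Suc n)) < \<eta> - L x"
          using reals_Archimedean[of "\<eta> - L x"] by auto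
        moreover have "\<eta> - 1 / real (Suc n) < L x" using x by blast
        ultimately show False by (simp add: inverse_eq_divide)
      qed
      with x show "x \<in> {x \<in> space M. \<eta> \<le> L x}" by auto
    next
      fix x assume x: "x \<in> {x \<in> space M. \<eta> \<le> L x}"
      have "\<eta> - 1 / real (Suc n) < \<eta>" for n by simp
      then have "\<eta> - 1 / real (Suc n) < L x" for n using x less_le_trans by blast
      with x show "x \<in> (\<Inter>n. ?F n)" by blast
    qed
    ultimately have "(\<lambda>n. C * prob (?F n)) \<longlonglongrightarrow> C * prob {x \<in> space M. \<eta> \<le> L x}"
      by (intro tendsto_mult) auto
    moreover have "1 \<le> C * prob (?F n)" for n
      using below[of "\<eta> - 1 / real (Suc n)"] by (simp add: S_def)
    ultimately show "1 \<le> C * prob {x \<in> space M. \<eta> \<le> L x}"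
      by (intro LIMSEQ_le_const) auto
  qed
qed

text \<open>Makes the real-valued \<open>INF\<close> in \<open>CVaR\<close> a lower bound of the
  objective values. The mean of \<open>L\<close> bounds them from below, since
  \<open>L - \<eta>\<close> is at most its positive part and \<open>C \<ge> 1\<close>.\<close>

lemma (in prob_space) bdd_below_CVaR:
  fixes L :: "'a \<Rightarrow> real"
  assumes [measurable]: "L \<in> borel_measurable M"
    and b: "\<And>x. x \<in> space M \<Longrightarrow> \<bar>L x\<bar> \<le> b"
    and "1 \<le> C"
  shows "bdd_below (range (\<lambda>\<eta>. \<eta> + C * (\<integral>x. max (L x - \<eta>) 0 \<partial>M)))"
proof (rule bdd_belowI2)
  fix \<eta> :: real
  have i: "integrable M L" using b by (intro integrable_const_bound[where B=b]) auto
  have im: "integrable M (\<lambda>x. max (L x - \<eta>) 0)" using i by auto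
  have "integral\<^sup>L M L - \<eta> = (\<integral>x. L x - \<eta> \<partial>M)" using i by (simp add: prob_space)
  also have "\<dots> \<le> (\<integral>x. max (L x - \<eta>) 0 \<partial>M)" using i im by (intro integral_mono) auto
  also have "\<dots> \<le> C * (\<integral>x. max (L x - \<eta>) 0 \<partial>M)"
    using mult_right_mono[OF \<open>1 \<le> C\<close>, of "\<integral>x. max (L x - \<eta>) 0 \<partial>M"] by simp
  finally show "integral\<^sup>L M L \<le> \<eta> + C * (\<integral>x. max (L x - \<eta>) 0 \<partial>M)" by simp
qed

text \<open>\<open>CVaR\<close> is at most its objective at the quantile \<open>\<eta>\<close>, and
  that value is exactly the integral of \<open>L\<close> under the density \<open>g\<close>.\<close>

lemma (in prob_space) CVaR_attained:
  fixes L :: "'a \<Rightarrow> real"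
  assumes L[measurable]: "L \<in> borel_measurable M"
    and b: "\<And>x. x \<in> space M \<Longrightarrow> \<bar>L x\<bar> \<le> b"
    and "1 \<le> C"
  obtains \<nu> where "prob_space \<nu>" "sets \<nu> = sets M"
    "\<And>B. B \<in> sets M \<Longrightarrow> measure \<nu> B \<le> C * measure M B"
    "CVaR C M L \<le> integral\<^sup>L \<nu> L"
proof -
  obtain \<eta> where \<eta>: "C * prob {x \<in> space M. \<eta> < L x} \<le> 1" "1 \<le> C * prob {x \<in> space M. \<eta> \<le> L x}"
    using ex_upper_quantile[OF L b \<open>1 \<le> C\<close>] by blast
  let ?U = "{x \<in> space M. \<eta> < L x}" and ?E = "{x \<in> space M. L x = \<eta>}"
  have split: "prob {x \<in> space M. \<eta> \<le> L x} = prob ?U + prob ?E"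
    by (subst finite_measure_Union[symmetric]) (auto intro!: arg_cong[where f=prob])
  \<comment> \<open>If the level set is null, then \<open>C * prob ?U = 1\<close> already and the junk value \<open>c = 0\<close> is right.\<close>
  define c where "c = (1 - C * prob ?U) / prob ?E"
  have c: "0 \<le> c" "c \<le> C" "c * prob ?E = 1 - C * prob ?U"
  proof -
    show "0 \<le> c" using \<eta> by (simp add: c_def)
    \<comment> \<open>By \<open>split\<close>, the second quantile inequality reads
      \<open>1 - C * prob ?U \<le> C * prob ?E\<close>; dividing by \<open>prob ?E\<close> gives the
      claim.\<close>
    show "c \<le> C"
      using \<eta> split \<open>1 \<le> C\<close> by (cases "prob ?E = 0")
        (auto simp: c_def divide_le_eq distrib_left less_le measure_nonneg)
    show "c * prob ?E = 1 - C * prob ?U"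
      using \<eta> split by (cases "prob ?E = 0") (auto simp: c_def)
  qed
  define g where "g x = C * indicator ?U x + c * indicator ?E x" for x
  have [measurable]: "g \<in> borel_measurable M" unfolding g_def by measurable
  have g: "0 \<le> g x" "g x \<le> C" for x
    using c \<open>1 \<le> C\<close> by (auto simp: g_def indicator_def)
  have ig: "integrable M g" using g by (intro integrable_const_bound[where B=C]) auto
  have g1: "integral\<^sup>L M g = 1"
  proof -
    have "integrable M (indicat_real ?U)" "integrable M (indicat_real ?E)"
      by (auto intro!: integrable_real_indicator simp: emeasure_eq_measure)
    with c(3) show ?thesis
      unfolding g_def[abs_def] by (subst Bochner_Integration.integral_add) auto
  qed
  define \<nu> where "\<nu> = density M g"
  have sets: "sets \<nu> = sets M" by (simp add: \<nu>_def)
  have iL: "integrable M L" using b by (intro integrable_const_bound[where B=b]) auto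
  show thesis
  proof
    show pr: "prob_space \<nu>"
    proof (rule prob_spaceI)
      have "emeasure \<nu> (space \<nu>) = (\<integral>\<^sup>+x. g x \<partial>M)"
        by (simp add: \<nu>_def emeasure_density cong: nn_integral_cong)
      also have "\<dots> = ennreal (integral\<^sup>L M g)" using ig g by (intro nn_integral_eq_integral) auto
      finally show "emeasure \<nu> (space \<nu>) = 1" using g1 by simp
    qed
    show "sets \<nu> = sets M" by fact
    show "measure \<nu> B \<le> C * measure M B" if [measurable]: "B \<in> sets M" for B
    proof -
      interpret \<nu>: prob_space \<nu> by fact
      have "emeasure \<nu> B = (\<integral>\<^sup>+x. ennreal (g x) * indicator B x \<partial>M)"
        by (simp add: \<nu>_def emeasure_density)
      also have "\<dots> \<le> (\<integral>\<^sup>+x. ennreal C * indicator B x \<partial>M)"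
        using g by (intro nn_integral_mono mult_right_mono) (auto intro: ennreal_leI)
      also have "\<dots> = ennreal (C * measure M B)"
        using \<open>1 \<le> C\<close> by (simp add: nn_integral_cmult_indicator emeasure_eq_measure ennreal_mult')
      finally show ?thesis
        using \<open>1 \<le> C\<close> by (simp add: \<nu>.emeasure_eq_measure)
    qed
    have im: "integrable M (\<lambda>x. max (L x - \<eta>) 0)" using iL by auto
    \<comment> \<open>Above \<open>\<eta>\<close> one has \<open>g = C\<close>; on the level set
      \<open>L = \<eta>\<close> and the positive part vanishes; below \<open>\<eta>\<close> both
      sides are \<open>0\<close>. Since \<open>g\<close> integrates to \<open>1\<close>, integration
      turns the right side into the CVaR objective at \<open>\<eta>\<close>.\<close>
    have pt: "g x * L x = \<eta> * g x + C * max (L x - \<eta>) 0" if "x \<in> space M" for x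
      using that by (auto simp: g_def indicator_def max_def algebra_simps)
    have "CVaR C M L \<le> \<eta> + C * (\<integral>x. max (L x - \<eta>) 0 \<partial>M)"
      unfolding CVaR_def using bdd_below_CVaR[OF L b \<open>1 \<le> C\<close>] by (rule cINF_lower) auto
    also have "\<dots> = (\<integral>x. \<eta> * g x + C * max (L x - \<eta>) 0 \<partial>M)"
      using ig im g1 by simp
    also have "\<dots> = (\<integral>x. g x * L x \<partial>M)"
      by (intro Bochner_Integration.integral_cong) (auto simp: pt)
    also have "\<dots> = integral\<^sup>L \<nu> L"
      using g by (simp add: \<nu>_def integral_real_density)
    finally show "CVaR C M L \<le> integral\<^sup>L \<nu> L" .
  qed
qed

section \<open>The maximal integral over admissible weights\<close>

text \<open>Weak duality: each \<open>\<eta>\<close> gives an upper bound. Dividing by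
  \<open>1 - k > 0\<close> leaves precisely the CVaR objective on the right, so the infimum over
  \<open>\<eta>\<close> can be taken.\<close>

lemma integral_ref_weights_le_CVaR:
  assumes m: "m \<in> space (prob_algebra A)" and M: "M \<in> space (prob_algebra A)"
    and k: "0 \<le> k" "k < 1" "1 \<le> K"
    and le: "\<forall>B\<in>sets A. k * measure m B \<le> K * measure M B"
    and L[measurable]: "L \<in> borel_measurable A"
    and b: "\<And>\<theta>. \<theta> \<in> space A \<Longrightarrow> \<bar>L \<theta>\<bar> \<le> b"
    and \<pi>: "\<pi> \<in> ref_weights A k K m M"
  shows "integral\<^sup>L \<pi> L \<le> k * integral\<^sup>L m L + (1 - k) * CVaR ((K - k) / (1 - k)) (Rbar k K m M) L"
proof -
  define R where "R = Rbar k K m M"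
  have R: "R \<in> space (prob_algebra A)"
    and mR: "\<And>B. B \<in> sets A \<Longrightarrow> measure R B = (K * measure M B - k * measure m B) / (K - k)"
    using Rbar_in_prob_algebra[OF m M k] measure_Rbar[OF m M k] le by (auto simp: R_def)
  have s[measurable_cong]: "sets m = sets A" "sets M = sets A" "sets R = sets A" "sets \<pi> = sets A"
    and pr: "prob_space m" "prob_space M" "prob_space R" "prob_space \<pi>"
    using m M R \<pi> by (auto simp: space_prob_algebra ref_weights_def)
  interpret m: prob_space m by fact
  interpret M: prob_space M by fact
  interpret R: prob_space R by fact
  interpret \<pi>: prob_space \<pi> by fact
  have sp: "space m = space A" "space M = space A" "space R = space A" "space \<pi> = space A"
    using s by (auto dest: sets_eq_imp_space_eq)
  have bound: "(integral\<^sup>L \<pi> L - k * integral\<^sup>L m L) / (1 - k)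
      \<le> \<eta> + (K - k) / (1 - k) * (\<integral>\<theta>. max (L \<theta> - \<eta>) 0 \<partial>R)" for \<eta>
  proof -
    let ?p = "\<lambda>\<theta>. max (L \<theta> - \<eta>) 0" and ?n = "\<lambda>\<theta>. max (\<eta> - L \<theta>) 0"
    have bp: "0 \<le> ?p \<theta> \<and> ?p \<theta> \<le> b + \<bar>\<eta>\<bar>" and bn: "0 \<le> ?n \<theta> \<and> ?n \<theta> \<le> b + \<bar>\<eta>\<bar>"
      if "\<theta> \<in> space A" for \<theta> using b[OF that] by auto
    have iL: "integrable \<pi> L" "integrable m L"
      using b sp by (auto intro!: \<pi>.integrable_const_bound[where B=b] m.integrable_const_bound[where B=b])
    have diff: "integral\<^sup>L N L = \<eta> + (integral\<^sup>L N ?p - integral\<^sup>L N ?n)"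
      if "prob_space N" "integrable N L" for N
    proof -
      interpret N: prob_space N by fact
      have "(\<integral>\<theta>. ?p \<theta> - ?n \<theta> \<partial>N) = (\<integral>\<theta>. L \<theta> - \<eta> \<partial>N)"
        by (intro Bochner_Integration.integral_cong) auto
      with that show ?thesis by (simp add: N.prob_space)
    qed
    have "1 * integral\<^sup>L \<pi> ?p \<le> K * integral\<^sup>L M ?p"
      using k bp \<pi> sp by (intro integral_mono_measure_le[where c="b + \<bar>\<eta>\<bar>"])
        (auto simp: s ref_weights_def intro: M.finite_measure_axioms \<pi>.finite_measure_axioms)
    moreover have "k * integral\<^sup>L m ?n \<le> 1 * integral\<^sup>L \<pi> ?n"
      using k bn \<pi> sp by (intro integral_mono_measure_le[where c="b + \<bar>\<eta>\<bar>"])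
        (auto simp: s ref_weights_def intro: m.finite_measure_axioms \<pi>.finite_measure_axioms)
    \<comment> \<open>The difference defining \<open>R\<close> is solved for \<open>M\<close>, which
      is then a combination of \<open>m\<close> and \<open>R\<close> with nonnegative coefficients;
      \<open>K \<ge> 1\<close> permits the division by \<open>K\<close>.\<close>
    moreover have "integral\<^sup>L M ?p = (k / K) * integral\<^sup>L m ?p + ((K - k) / K) * integral\<^sup>L R ?p"
      using k bp sp by (intro integral_linear_combination[where c="b + \<bar>\<eta>\<bar>"])
        (auto simp: s mR field_simps intro: m.finite_measure_axioms M.finite_measure_axioms
          R.finite_measure_axioms)
    then have "K * integral\<^sup>L M ?p = k * integral\<^sup>L m ?p + (K - k) * integral\<^sup>L R ?p"
      using k by (simp add: field_simps)
    \<comment> \<open>The cap on \<open>?p\<close> contributes \<open>k\<close> times the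
      \<open>m\<close>-integral of \<open>?p\<close>, the floor on \<open>?n\<close> subtracts
      \<open>k\<close> times that of \<open>?n\<close>; together they restore
      \<open>L - \<eta>\<close> under \<open>m\<close>.\<close>
    ultimately have "integral\<^sup>L \<pi> L \<le> \<eta> + k * (integral\<^sup>L m L - \<eta>) + (K - k) * integral\<^sup>L R ?p"
      unfolding diff[OF pr(4) iL(1)] diff[OF pr(1) iL(2)] by (simp add: algebra_simps)
    then have "integral\<^sup>L \<pi> L - k * integral\<^sup>L m L \<le> (1 - k) * \<eta> + (K - k) * integral\<^sup>L R ?p"
      by (simp add: algebra_simps)
    also have "\<dots> = (1 - k) * (\<eta> + (K - k) / (1 - k) * integral\<^sup>L R ?p)"
      using k by (simp add: distrib_left)
    finally show ?thesis
      using k by (simp add: pos_divide_le_eq mult.commute)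
  qed
  have "(integral\<^sup>L \<pi> L - k * integral\<^sup>L m L) / (1 - k) \<le> CVaR ((K - k) / (1 - k)) R L"
    unfolding CVaR_def by (rule cINF_greatest[OF UNIV_not_empty bound])
  with k show ?thesis by (simp add: R_def field_simps)
qed

text \<open>The floor \<open>k m\<close> is fixed and the remaining mass \<open>1 - k\<close> is
  spread as the measure \<open>\<nu>\<close> extremal for \<open>CVaR\<close>. The constant
  \<open>C\<close> is the one for which \<open>\<nu> \<le> C R\<close> becomes the cap
  \<open>K M\<close>.\<close>

lemma ref_weights_attain_CVaR:
  assumes m: "m \<in> space (prob_algebra A)" and M: "M \<in> space (prob_algebra A)"
    and k: "0 \<le> k" "k < 1" "1 \<le> K"
    and le: "\<forall>B\<in>sets A. k * measure m B \<le> K * measure M B"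
    and L[measurable]: "L \<in> borel_measurable A"
    and b: "\<And>\<theta>. \<theta> \<in> space A \<Longrightarrow> \<bar>L \<theta>\<bar> \<le> b"
  obtains \<pi> where "\<pi> \<in> ref_weights A k K m M"
    "k * integral\<^sup>L m L + (1 - k) * CVaR ((K - k) / (1 - k)) (Rbar k K m M) L \<le> integral\<^sup>L \<pi> L"
proof -
  define R where "R = Rbar k K m M"
  let ?C = "(K - k) / (1 - k)"
  have R: "R \<in> space (prob_algebra A)"
    and mR: "\<And>B. B \<in> sets A \<Longrightarrow> measure R B = (K * measure M B - k * measure m B) / (K - k)"
    using Rbar_in_prob_algebra[OF m M k] measure_Rbar[OF m M k] le by (auto simp: R_def)
  have s[measurable_cong]: "sets m = sets A" "sets R = sets A"
    and pr: "prob_space m" "prob_space R"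
    using m R by (auto simp: space_prob_algebra)
  interpret R: prob_space R by fact
  have spR: "space R = space A" using s by (auto dest: sets_eq_imp_space_eq)
  have "L \<in> borel_measurable R" by measurable
  then obtain \<nu> where \<nu>: "prob_space \<nu>" "sets \<nu> = sets R"
    "\<And>B. B \<in> sets R \<Longrightarrow> measure \<nu> B \<le> ?C * measure R B" "CVaR ?C R L \<le> integral\<^sup>L \<nu> L"
    using k b by (elim R.CVaR_attained[where b=b and C="?C"]) (auto simp: spR)
  have \<nu>A: "\<nu> \<in> space (prob_algebra A)" using \<nu> s by (simp add: space_prob_algebra)
  obtain \<pi> where \<pi>: "\<pi> \<in> space (prob_algebra A)"
    "\<And>B. B \<in> sets A \<Longrightarrow> measure \<pi> B = k * measure m B + (1 - k) * measure \<nu> B"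
    using ex_mixture_prob_algebra[OF m \<nu>A, of k] k by auto
  have s\<pi>[measurable_cong]: "sets \<pi> = sets A" and "prob_space \<pi>"
    using \<pi> by (auto simp: space_prob_algebra)
  have sp\<pi>: "space \<pi> = space A" by (rule sets_eq_imp_space_eq[OF s\<pi>])
  have I: "integral\<^sup>L \<pi> L = k * integral\<^sup>L m L + (1 - k) * integral\<^sup>L \<nu> L"
    using k b \<pi>(2) \<nu>(2) sp\<pi>
    by (intro integral_linear_combination[where c=b])
      (auto simp: s s\<pi> intro: prob_space.finite_measure pr \<nu>(1) \<open>prob_space \<pi>\<close>)
  show thesis
  proof
    have "measure \<pi> B \<le> K * measure M B" if B: "B \<in> sets A" for B
    proof -
      \<comment> \<open>Here \<open>(1 - k) * ?C = K - k\<close> cancels the normalisation of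
        \<open>R\<close>, leaving exactly the room \<open>K M - k m\<close> above the floor.\<close>
      have "(1 - k) * measure \<nu> B \<le> (1 - k) * (?C * measure R B)"
        using \<nu>(3)[of B] B s k by (intro mult_left_mono) auto
      also have "\<dots> = K * measure M B - k * measure m B"
        using k by (simp add: mR[OF B])
      finally show ?thesis by (simp add: \<pi>(2)[OF B])
    qed
    then show "\<pi> \<in> ref_weights A k K m M"
      using \<pi> k by (auto simp: ref_weights_def)
    show "k * integral\<^sup>L m L + (1 - k) * CVaR ?C (Rbar k K m M) L \<le> integral\<^sup>L \<pi> L"
      using \<nu>(4) k by (simp add: I R_def)
  qed
qed

section \<open>Dominance as a sign condition on integrals\<close>

text \<open>Fubini moves the expectation under \<open>P\<close> or \<open>Q\<close> inside the
  integral over \<open>\<theta>\<close>. The constant \<open>a\<close> cancels between two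
  probability measures, and \<open>\<tau> \<ge> 0\<close> keeps the sign.\<close>

lemma rwsd_iff_integral_Gamma_diff:
  assumes \<phi>: "\<phi> \<in> borel_measurable (borel \<Otimes>\<^sub>M A)"
    and b: "\<And>x \<theta>. \<theta> \<in> space A \<Longrightarrow> \<bar>\<phi> (x, \<theta>)\<bar> \<le> b"
    and P: "P \<in> space (prob_algebra borel)" and Q: "Q \<in> space (prob_algebra borel)"
  shows "rwsd A \<phi> k K m M Q P \<longleftrightarrow>
    (\<forall>\<pi>\<in>ref_weights A k K m M. 0 \<le> (\<integral>\<theta>. Gamma_diff \<phi> P Q \<theta> \<partial>\<pi>))"
proof -
  have utility: "(\<integral>x. a + \<tau> * (\<integral>\<theta>. \<phi> (x, \<theta>) \<partial>\<pi>) \<partial>N) = a + \<tau> * (\<integral>\<theta>. (\<integral>x. \<phi> (x, \<theta>) \<partial>N) \<partial>\<pi>)"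
      "integrable \<pi> (\<lambda>\<theta>. \<integral>x. \<phi> (x, \<theta>) \<partial>N)"
    if N: "N \<in> space (prob_algebra borel)" and \<pi>: "\<pi> \<in> ref_weights A k K m M" for N \<pi> a \<tau>
  proof -
    have s[measurable_cong]: "sets N = sets borel" "sets \<pi> = sets A"
      and pr: "prob_space N" "prob_space \<pi>"
      using N \<pi> by (auto simp: space_prob_algebra ref_weights_def)
    interpret N: prob_space N by fact
    interpret \<pi>: prob_space \<pi> by fact
    interpret pair: pair_prob_space N \<pi> ..
    have sp: "space \<pi> = space A" by (rule sets_eq_imp_space_eq[OF s(2)])
    have "\<phi> \<in> borel_measurable (N \<Otimes>\<^sub>M \<pi>)"
      using \<phi> s by (simp cong: measurable_cong_sets sets_pair_measure_cong)
    then have i: "integrable (N \<Otimes>\<^sub>M \<pi>) \<phi>"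
      using b by (intro pair.integrable_const_bound[where B=b]) (auto simp: space_pair_measure sp)
    \<comment> \<open>The curried form is the shape in which the Fubini rules for pairs are
      stated.\<close>
    then have i': "integrable (N \<Otimes>\<^sub>M \<pi>) (\<lambda>(x, \<theta>). \<phi> (x, \<theta>))" by simp
    show "integrable \<pi> (\<lambda>\<theta>. \<integral>x. \<phi> (x, \<theta>) \<partial>N)" by (rule pair.integrable_snd[OF i'])
    have "integrable N (\<lambda>x. \<integral>\<theta>. \<phi> (x, \<theta>) \<partial>\<pi>)" by (rule pair.integrable_fst[OF i'])
    then show "(\<integral>x. a + \<tau> * (\<integral>\<theta>. \<phi> (x, \<theta>) \<partial>\<pi>) \<partial>N) = a + \<tau> * (\<integral>\<theta>. (\<integral>x. \<phi> (x, \<theta>) \<partial>N) \<partial>\<pi>)"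
      by (simp add: N.prob_space pair.Fubini_integral[OF i'])
  qed
  have diff: "(\<integral>x. a + \<tau> * (\<integral>\<theta>. \<phi> (x, \<theta>) \<partial>\<pi>) \<partial>P) \<le> (\<integral>x. a + \<tau> * (\<integral>\<theta>. \<phi> (x, \<theta>) \<partial>\<pi>) \<partial>Q)
      \<longleftrightarrow> 0 \<le> \<tau> * (\<integral>\<theta>. Gamma_diff \<phi> P Q \<theta> \<partial>\<pi>)"
    if "\<pi> \<in> ref_weights A k K m M" for \<pi> a \<tau>
    using that by (simp add: utility P Q Gamma_diff_def algebra_simps)
  show ?thesis
  proof
    assume rwsd: "rwsd A \<phi> k K m M Q P"
    show "\<forall>\<pi>\<in>ref_weights A k K m M. 0 \<le> (\<integral>\<theta>. Gamma_diff \<phi> P Q \<theta> \<partial>\<pi>)"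
    proof
      fix \<pi> assume \<pi>: "\<pi> \<in> ref_weights A k K m M"
      \<comment> \<open>The choice \<open>a = 0\<close>, \<open>\<tau> = 1\<close> isolates
        \<open>\<pi>\<close>; it is left unsimplified to match the set comprehension
        literally.\<close>
      then have "(\<lambda>x. 0 + 1 * (\<integral>\<theta>. \<phi> (x, \<theta>) \<partial>\<pi>)) \<in> ref_utilities A \<phi> k K m M"
        unfolding ref_utilities_def using zero_le_one by blast
      with rwsd diff[OF \<pi>, of 0 1] show "0 \<le> (\<integral>\<theta>. Gamma_diff \<phi> P Q \<theta> \<partial>\<pi>)"
        unfolding rwsd_def by (simp del: mult_1 add_0)
    qed
  qed (auto simp: rwsd_def ref_utilities_def diff)
qed

theorem theorem3p4:
  fixes A :: "'t measure"
    and \<phi> :: "'x::polish_space \<times> 't \<Rightarrow> real"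
    and k K :: real
    and m M :: "'t measure"
    and P Q :: "'x measure"
  assumes "\<phi> \<in> borel_measurable (borel \<Otimes>\<^sub>M A)"
    and "bounded (\<phi> ` (UNIV \<times> space A))"
    and "m \<in> space (prob_algebra A)" and "M \<in> space (prob_algebra A)"
    and "0 \<le> k" and "k < 1" and "1 \<le> K"
    and "\<forall>B\<in>sets A. k * measure m B \<le> K * measure M B"
    and "P \<in> space (prob_algebra borel)" and "Q \<in> space (prob_algebra borel)"
  shows "rwsd A \<phi> k K m M Q P \<longleftrightarrow>
    - k * (\<integral>\<theta>. Gamma_diff \<phi> P Q \<theta> \<partial>m)
      + (1 - k) * CVaR ((K - k) / (1 - k)) (Rbar k K m M) (\<lambda>\<theta>. - Gamma_diff \<phi> P Q \<theta>) \<le> 0"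
proof -
  obtain b where b: "\<And>x \<theta>. \<theta> \<in> space A \<Longrightarrow> \<bar>\<phi> (x, \<theta>)\<bar> \<le> b"
    using assms(2) by (auto simp: bounded_iff)
  let ?L = "\<lambda>\<theta>. - Gamma_diff \<phi> P Q \<theta>"
  have int: "(\<lambda>\<theta>. \<integral>x. \<phi> (x, \<theta>) \<partial>N) \<in> borel_measurable A"
    "\<theta> \<in> space A \<Longrightarrow> \<bar>\<integral>x. \<phi> (x, \<theta>) \<partial>N\<bar> \<le> b"
    if N: "N \<in> space (prob_algebra borel)" for N :: "'x measure" and \<theta>
  proof -
    have s[measurable_cong]: "sets N = sets borel" and "prob_space N"
      using N by (auto simp: space_prob_algebra)
    interpret N: prob_space N by fact
    note assms(1)[measurable]
    show "(\<lambda>\<theta>. \<integral>x. \<phi> (x, \<theta>) \<partial>N) \<in> borel_measurable A" by measurable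
    assume \<theta>[measurable]: "\<theta> \<in> space A"
    have "\<bar>\<integral>x. \<phi> (x, \<theta>) \<partial>N\<bar> \<le> (\<integral>x. \<bar>\<phi> (x, \<theta>)\<bar> \<partial>N)" by (rule integral_abs_bound)
    also have "\<dots> \<le> b"
      using b[OF \<theta>] by (intro N.integral_le_const N.integrable_const_bound[where B=b]) auto
    finally show "\<bar>\<integral>x. \<phi> (x, \<theta>) \<partial>N\<bar> \<le> b" .
  qed
  have L: "?L \<in> borel_measurable A"
    unfolding Gamma_diff_def using int(1)[OF assms(9)] int(1)[OF assms(10)] by measurable
  have bL: "\<bar>?L \<theta>\<bar> \<le> 2 * b" if "\<theta> \<in> space A" for \<theta>
    unfolding Gamma_diff_def using int(2)[OF assms(9) that] int(2)[OF assms(10) that] by linarith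
  \<comment> \<open>As \<open>?L\<close> is the negative of \<open>Gamma_diff\<close>, the left side
    of the claimed inequality is \<open>k\<close> times the \<open>m\<close>-integral of
    \<open>?L\<close> plus the CVaR term. By \<open>upper\<close> and \<open>attained\<close> it is
    the maximum of the integrals of \<open>?L\<close> over admissible weights, and dominance says
    that none of these is positive.\<close>
  note upper = integral_ref_weights_le_CVaR[OF assms(3-8) L bL]
  note attained = ref_weights_attain_CVaR[OF assms(3-8) L bL]
  have iff: "rwsd A \<phi> k K m M Q P \<longleftrightarrow>
      (\<forall>\<pi>\<in>ref_weights A k K m M. 0 \<le> (\<integral>\<theta>. Gamma_diff \<phi> P Q \<theta> \<partial>\<pi>))"
    by (rule rwsd_iff_integral_Gamma_diff[OF assms(1) _ assms(9,10)]) (rule b)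
  show ?thesis (is "_ \<longleftrightarrow> ?V \<le> 0")
    unfolding iff
  proof
    assume *: "\<forall>\<pi>\<in>ref_weights A k K m M. 0 \<le> (\<integral>\<theta>. Gamma_diff \<phi> P Q \<theta> \<partial>\<pi>)"
    show "?V \<le> 0"
    proof -
      obtain \<pi> where "\<pi> \<in> ref_weights A k K m M"
        "k * integral\<^sup>L m ?L + (1 - k) * CVaR ((K - k) / (1 - k)) (Rbar k K m M) ?L \<le> integral\<^sup>L \<pi> ?L"
        using attained by blast
      with * show ?thesis by force
    qed
  next
    assume "?V \<le> 0"
    then show "\<forall>\<pi>\<in>ref_weights A k K m M. 0 \<le> (\<integral>\<theta>. Gamma_diff \<phi> P Q \<theta> \<partial>\<pi>)"
      using upper by fastforce
  qed
qed

end
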